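(* Let $n\ge1$, let $\mu$ be a weak composition of $n$, and let $k,l\ge0$. There is a bijection $$\phi:\mathsf{SW}(\mu,k,l)\to\mathsf{LD}_0(\mu)^{\ast k,\bullet l}$$ extending both the bijection $\beta^{\ast}:\mathsf{OP}(\mu,n-k)\to\mathsf{LD}_0(\mu)^{\ast k}$ and the bijection $\beta^{\bullet}:\mathsf{OP}(\mu,n-l)\to\mathsf{LD}_0(\mu)^{\bullet l}$; that is, $\phi=\beta^{\ast}\circ\Pi$ when $l=0$, and $\phi=\beta^{\bullet}\circ\Pi$ when $k=0$.
   Context: A weak composition $\mu=(\mu_1,\mu_2,\dots)$ of $n$ is a sequence of nonnegative integers with sum $n$; an object has content $\mu$ if its multiset of letters (or labels, or elements) is $\{i^{\mu_i}:i>0\}$. Words. A Smirnov word is a finite word in positive integers with no two equal adjacent letters. A segmented Smirnov word of length $n$ is a word $w=w_1\cdots w_n$ of positive integers together with a composition $(\alpha_1,\dots,\alpha_s)$ of $n$ into positive parts such that, writing $w=w^1\cdots w^s$ with $w^i$ of length $\alpha_i$, each block $w^i$ is a Smirnov word. Index $i$ is an ascent (descent) if $i,i+1$ lie in the same block and $w_i<w_{i+1}$ ($w_i>w_{i+1}$). $\mathsf{SW}(\mu,k,l)$ is the set of segmented Smirnov words with content $\mu$, exactly $k$ ascents and exactly $l$ descents. Ordered multiset partitions. $\mathsf{OP}(\mu,r)$ is the set of sequences $(\pi_1,\dots,\pi_r)$ of nonempty sets of positive integers (no repeated element within a set) whose multiset union has content $\mu$. The map $\Pi$ sends a segmented Smirnov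 word $(w^1,\dots,w^s)$ to the sequence of multisets of letters of its blocks; it restricts to bijections $\mathsf{SW}(\mu,k,0)\to\mathsf{OP}(\mu,n-k)$ and $\mathsf{SW}(\mu,0,l)\to\mathsf{OP}(\mu,n-l)$. Paths. A Dyck path of size $n$ is a lattice path from $(0,0)$ to $(n,n)$ with unit North ($N$) and East ($E$) steps staying weakly above $x=y$. A labelled Dyck path also has a positive integer label on each vertical step, labels on consecutive vertical steps being strictly increasing from bottom to top. A rise is a vertical step preceded by a vertical step. A valley is a vertical step $v$ preceded by a horizontal step; it is contractible if it is preceded by two horizontal steps, or by a horizontal step itself preceded by a vertical step whose label is strictly smaller than that of $v$. $\mathsf{LD}(\mu)^{\ast k,\bullet l}$ is the set of labelled Dyck paths with label content $\mu$ together with a choice of $k$ decorated rises and $l$ decorated contractible valleys. The area word $a_1\cdots a_n$ has $a_i$ = number of whole squares between the $i$-th vertical step and the line $x=y$, and the area is the sum of $a_i$ over those $i$ for which the $i$-th vertical step is not a decorated rise. $\mathsf{LD}_0(\mu)^{\ast k,\bullet l}$ is the subset of those of area $0$ (equivalently: every rise is decorated and every valley lies on the main diagonal). $\mathsf{LD}_0(\mu)^{\ast k}$ means $l=0$ and $\mathsf{LD}_0(\mu)^{\bullet l}$ means $k=0$. The bijections from ordered multiset partitions. $\beta^\ast$ sends $(\pi_1,\dots,\pi_r)$ to the path $N^{|\pi_r|}E^{|\pi_r|}N^{|\pi_{r-1}|}E^{|\pi_{r-1}|}\cdots N^{|\pi_1|}E^{|\pi_1|}$, in which the vertical run corresponding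 to $\pi_i$ is labelled by the elements of $\pi_i$ (increasingly from bottom to top) and all rises are decorated. $\beta^\bullet$ sends $(\pi_1,\dots,\pi_r)$ to the path $(NE)^n$ whose labels, from bottom to top, are the elements of $\pi_r$ in increasing order, then those of $\pi_{r-1}$ in increasing order, and so on down to $\pi_1$, with all vertical steps decorated except those carrying the minimum of each $\pi_i$. *)

theory Defs
  imports "HOL-Library.Multiset"
begin

section \<open>Weak compositions and contents\<close>

text \<open>A sequence \<open>\<mu>\<^sub>1, \<mu>\<^sub>2, \<dots>\<close> is a function on \<^typ>\<open>nat\<close> whose value at \<open>0\<close> is ignored throughout.\<close>

definition weak_composition :: "nat \<Rightarrow> (nat \<Rightarrow> nat) \<Rightarrow> bool" where
  "weak_composition n \<mu> \<longleftrightarrow>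
     finite {i. i > 0 \<and> \<mu> i \<noteq> 0} \<and> (\<Sum>i | i > 0 \<and> \<mu> i \<noteq> 0. \<mu> i) = n"

text \<open>In particular, a multiset with content \<open>\<mu>\<close> consists of positive integers.\<close>

definition has_content :: "nat multiset \<Rightarrow> (nat \<Rightarrow> nat) \<Rightarrow> bool" where
  "has_content M \<mu> \<longleftrightarrow> (\<forall>i. count M i = (if i > 0 then \<mu> i else 0))"


section \<open>Segmented Smirnov words\<close>

definition smirnov :: "nat list \<Rightarrow> bool" where
  "smirnov w \<longleftrightarrow> (\<forall>a \<in> set w. a > 0) \<and> (\<forall>i. Suc i < length w \<longrightarrow> w ! i \<noteq> w ! Suc i)"

text \<open>A word \<open>w\<close> with a composition \<open>\<alpha>\<close> of its length is given by the list
  \<open>[w\<^sup>1, \<dots>, w\<^sup>s]\<close> of its nonempty blocks: \<open>w\<close> is the concatenation of the blocks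
  and \<open>\<alpha>\<close> is the list of their lengths.\<close>

definition segmented_smirnov :: "nat list list \<Rightarrow> bool" where
  "segmented_smirnov ws \<longleftrightarrow> (\<forall>b \<in> set ws. b \<noteq> [] \<and> smirnov b)"

definition ascents :: "nat list list \<Rightarrow> nat" where
  "ascents ws = (\<Sum>b\<leftarrow>ws. card {i. Suc i < length b \<and> b ! i < b ! Suc i})"

definition descents :: "nat list list \<Rightarrow> nat" where
  "descents ws = (\<Sum>b\<leftarrow>ws. card {i. Suc i < length b \<and> b ! i > b ! Suc i})"

definition SW :: "(nat \<Rightarrow> nat) \<Rightarrow> nat \<Rightarrow> nat \<Rightarrow> nat list list set" where
  "SW \<mu> k l = {ws. segmented_smirnov ws \<and> has_content (mset (concat ws)) \<mu> \<and>
                    ascents ws = k \<and> descents ws = l}"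


section \<open>Ordered multiset partitions\<close>

text \<open>The parts are sets, represented as multisets without repeated elements, so that
  \<open>block_contents\<close> below can map arbitrary segmented Smirnov words to the same type.\<close>

definition OP :: "(nat \<Rightarrow> nat) \<Rightarrow> nat \<Rightarrow> nat multiset list set" where
  "OP \<mu> r = {ps. length ps = r \<and> (\<forall>p \<in> set ps. p \<noteq> {#} \<and> (\<forall>a. count p a \<le> 1)) \<and>
                 has_content (sum_list ps) \<mu>}"

text \<open>The map \<open>\<Pi>\<close>.\<close>

definition block_contents :: "nat list list \<Rightarrow> nat multiset list" where
  "block_contents ws = map mset ws"


section \<open>Labelled Dyck paths\<close>

text \<open>Each North step carries its label. Steps are referred to by their position in the list.\<close>

datatype step = North nat | East

type_synonym path = "step list"

definition is_north :: "step \<Rightarrow> bool" where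
  "is_north s \<longleftrightarrow> s \<noteq> East"

definition norths :: "path \<Rightarrow> nat" where
  "norths p = length (filter is_north p)"

definition easts :: "path \<Rightarrow> nat" where
  "easts p = length (filter (\<lambda>s. s = East) p)"

definition labels :: "path \<Rightarrow> nat multiset" where
  "labels p = mset [a. North a \<leftarrow> p]"

definition verticals :: "path \<Rightarrow> nat set" where
  "verticals p = {j. j < length p \<and> is_north (p ! j)}"

text \<open>The size of a Dyck path is its number of North steps.\<close>

definition dyck_path :: "path \<Rightarrow> bool" where
  "dyck_path p \<longleftrightarrow> norths p = easts p \<and>
     (\<forall>j \<le> length p. easts (take j p) \<le> norths (take j p))"

definition labelled_dyck_path :: "path \<Rightarrow> bool" where
  "labelled_dyck_path p \<longleftrightarrow> dyck_path p \<and> (\<forall>a \<in># labels p. a > 0) \<and>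
     (\<forall>j a b. Suc j < length p \<and> p ! j = North a \<and> p ! Suc j = North b \<longrightarrow> a < b)"

definition rises :: "path \<Rightarrow> nat set" where
  "rises p = {j \<in> verticals p. j \<ge> 1 \<and> is_north (p ! (j - 1))}"

definition valleys :: "path \<Rightarrow> nat set" where
  "valleys p = {j \<in> verticals p. j \<ge> 1 \<and> p ! (j - 1) = East}"

definition contractible_valleys :: "path \<Rightarrow> nat set" where
  "contractible_valleys p = {j \<in> valleys p. j \<ge> 2 \<and>
     (p ! (j - 2) = East \<or> (\<exists>a b. p ! (j - 2) = North a \<and> p ! j = North b \<and> a < b))}"

text \<open>A decorated path is a triple of a path, its set of decorated rises and its set of
  decorated contractible valleys.\<close>

type_synonym decorated_path = "path \<times> nat set \<times> nat set"

definition LD :: "(nat \<Rightarrow> nat) \<Rightarrow> nat \<Rightarrow> nat \<Rightarrow> decorated_path set" where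
  "LD \<mu> k l = {(p, R, V). labelled_dyck_path p \<and> has_content (labels p) \<mu> \<and>
                 R \<subseteq> rises p \<and> card R = k \<and> V \<subseteq> contractible_valleys p \<and> card V = l}"

text \<open>The entry of the area word at the vertical step at position \<open>j\<close>. This step goes from
  \<open>(x, y)\<close> to \<open>(x, y + 1)\<close>, where \<open>x\<close> and \<open>y\<close> count the preceding East and North steps;
  in a Dyck path \<open>x \<le> y\<close>, so the subtraction does not truncate.\<close>

definition area_word :: "path \<Rightarrow> nat \<Rightarrow> nat" where
  "area_word p j = norths (take j p) - easts (take j p)"

definition area :: "decorated_path \<Rightarrow> nat" where
  "area = (\<lambda>(p, R, V). \<Sum>j \<in> verticals p - R. area_word p j)"

definition LD0 :: "(nat \<Rightarrow> nat) \<Rightarrow> nat \<Rightarrow> nat \<Rightarrow> decorated_path set" where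
  "LD0 \<mu> k l = {d \<in> LD \<mu> k l. area d = 0}"


section \<open>From ordered multiset partitions to decorated paths\<close>

definition beta_star_path :: "nat multiset list \<Rightarrow> path" where
  "beta_star_path ps =
     concat (map (\<lambda>p. map North (sorted_list_of_multiset p) @ replicate (size p) East) (rev ps))"

definition beta_star :: "nat multiset list \<Rightarrow> decorated_path" where
  "beta_star ps = (beta_star_path ps, rises (beta_star_path ps), {})"

text \<open>The labels from bottom to top, each with a flag telling whether its vertical step
  is decorated.\<close>

definition beta_bullet_labels :: "nat multiset list \<Rightarrow> (nat \<times> bool) list" where
  "beta_bullet_labels ps =
     concat (map (\<lambda>p. map (\<lambda>a. (a, a \<noteq> Min (set_mset p))) (sorted_list_of_multiset p)) (rev ps))"

text \<open>In the path \<open>(NE)\<^sup>n\<close>, the \<open>i\<close>-th vertical step (counting from \<open>0\<close>) is at position \<open>2 * i\<close>.\<close>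

definition beta_bullet :: "nat multiset list \<Rightarrow> decorated_path" where
  "beta_bullet ps =
     (let xs = beta_bullet_labels ps in
       (concat (map (\<lambda>(a, d). [North a, East]) xs),
        {}, {2 * i | i. i < length xs \<and> snd (xs ! i)}))"

end

theory Submission
  imports Defs
begin

text \<open>Cut every block of a segmented Smirnov word at its descents. The word becomes a sequence of
  increasing runs, some of them flagged as joined to the next run \<open>c\<close> by a descent; a run \<open>b\<close> can be
  joined iff \<open>max b > min c\<close>. Likewise, a path of area \<open>0\<close> is a sequence of blocks
  \<open>N\<^sup>m E\<^sup>m\<close> with increasing labels; read from top to bottom, a block \<open>b\<close> may be flagged as
  starting with a decorated valley iff the next block \<open>c\<close> satisfies
  \<open>|c| \<ge> 2\<close> or \<open>min c < min b\<close>. So a content-preserving bijection between the pairs \<open>(b, c)\<close> of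
  the two kinds is needed. Pairs of both kinds are fixed. Otherwise a pair of the first
  kind has \<open>c = {a}\<close> with \<open>min b \<le> a < max b\<close>, and is sent to
  \<open>({x \<in> b. x \<le> a}, {a} \<union> {x \<in> b. x > a})\<close>. This preserves both minima, so
  it can be applied to all flagged pairs one after the other, from right to left: the first
  condition depends on \<open>c\<close>, and the second on \<open>b\<close>, only through the minimum. Nothing is changed
  if there are no descents or no ascents, which gives the two special cases.\<close>


section \<open>Exchanging descents and decorated valleys\<close>

definition run :: "nat list \<Rightarrow> bool" where
  "run b \<longleftrightarrow> b \<noteq> [] \<and> sorted_wrt (<) b \<and> (\<forall>a \<in> set b. 0 < a)"

definition descent_link :: "nat list \<Rightarrow> nat list \<Rightarrow> bool" where
  "descent_link b c \<longleftrightarrow> hd c < last b"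

definition valley_link :: "nat list \<Rightarrow> nat list \<Rightarrow> bool" where
  "valley_link b c \<longleftrightarrow> 2 \<le> length c \<or> hd c < hd b"

fun linked :: "(nat list \<Rightarrow> nat list \<Rightarrow> bool) \<Rightarrow> (nat list \<times> bool) list \<Rightarrow> bool" where
  "linked P [] \<longleftrightarrow> True"
| "linked P ((b, f) # rs) \<longleftrightarrow> run b \<and> (f \<longrightarrow> rs \<noteq> [] \<and> P b (fst (hd rs))) \<and> linked P rs"

text \<open>A run of length \<open>m\<close> has \<open>m - 1\<close> ascents and, as a block of a
  path, \<open>m - 1\<close> rises. Their total \<open>k\<close> is expressed through the number of
  runs, by a sum that avoids truncated subtraction.\<close>

definition run_lists :: "(nat list \<Rightarrow> nat list \<Rightarrow> bool) \<Rightarrow> (nat \<Rightarrow> nat) \<Rightarrow> nat \<Rightarrow> nat \<Rightarrow> (nat list \<times> bool) list set" where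
  "run_lists P \<mu> k l = {rs. linked P rs \<and> has_content (mset (concat (map fst rs))) \<mu> \<and>
     length (concat (map fst rs)) = k + length rs \<and> length (filter snd rs) = l}"

section \<open>The exchange on a single pair of runs\<close>

definition to_valley :: "nat list \<Rightarrow> nat list \<Rightarrow> nat list \<times> nat list" where
  "to_valley b c = (if valley_link b c then (b, c)
     else (filter (\<lambda>x. x \<le> hd c) b, hd c # filter (\<lambda>x. hd c < x) b))"

text \<open>For runs with \<open>last b \<le> hd c\<close>, the list \<open>b @ tl c\<close> is
  increasing, and splitting it at \<open>hd c\<close> gives back \<open>b\<close> and
  \<open>tl c\<close>. This undoes the second branch of \<open>to_valley\<close>.\<close>

definition to_descent :: "nat list \<Rightarrow> nat list \<Rightarrow> nat list \<times> nat list" where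
  "to_descent b c = (if descent_link b c then (b, c) else (b @ tl c, [hd c]))"

lemma sorted_filter_append:
  "sorted_wrt (<) b \<Longrightarrow> filter (\<lambda>x. x \<le> a) b @ filter (\<lambda>x. (a::nat) < x) b = b"
proof (induction b)
  case (Cons x b)
  show ?case
  proof (cases "x \<le> a")
    case False
    then have "filter (\<lambda>x. x \<le> a) b = []" "filter (\<lambda>x. a < x) b = b"
      using Cons.prems by (force simp: filter_empty_conv filter_id_conv)+
    then show ?thesis using False by simp
  qed (use Cons in auto)
qed simp

lemma run_last_ge: "run b \<Longrightarrow> x \<in> set b \<Longrightarrow> x \<le> last b"
  unfolding run_def by (induction b) (auto simp: less_imp_le)

text \<open>These are the pairs that \<open>to_valley\<close> changes. A run \<open>c\<close> of two
  or more letters is a valley link at once, so only singletons remain.\<close>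

lemma not_valley_link:
  assumes "run b" "run c" "\<not> valley_link b c"
  obtains a where "c = [a]" "hd b \<le> a" "0 < a"
proof -
  have "length c = 1" using assms by (cases c) (auto simp: valley_link_def run_def not_le less_Suc_eq)
  then obtain a where "c = [a]" by (auto simp: length_Suc_conv)
  then show thesis using assms that[of a] by (auto simp: valley_link_def run_def)
qed

text \<open>In the changed case \<open>hd b\<close> is at most \<open>a\<close> and stays in
  \<open>y\<close>, while \<open>last b\<close> exceeds \<open>a\<close> by
  \<open>descent_link\<close> and moves to \<open>z\<close>. Hence \<open>y\<close> keeps its
  minimum and \<open>z\<close> has at least two letters. All of \<open>y\<close> is at most
  \<open>hd z\<close>, so \<open>to_descent\<close> takes its second branch.\<close>

lemma to_valley:
  assumes "run b" "run c" "descent_link b c" "to_valley b c = (y, z)"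
  shows "run y" "run z" "valley_link y z" "hd y = hd b" "hd z = hd c"
    "mset y + mset z = mset b + mset c" "to_descent y z = (b, c)"
proof -
  have "run y \<and> run z \<and> valley_link y z \<and> hd y = hd b \<and> hd z = hd c \<and>
    mset y + mset z = mset b + mset c \<and> to_descent y z = (b, c)"
  proof (cases "valley_link b c")
    case True
    then show ?thesis using assms by (auto simp: to_valley_def to_descent_def)
  next
    case False
    then obtain a where a: "c = [a]" "hd b \<le> a" "0 < a" using assms not_valley_link by blast
    have y: "y = filter (\<lambda>x. x \<le> a) b" and z: "z = a # filter (\<lambda>x. a < x) b"
      using assms(4) False a by (auto simp: to_valley_def)
    have b: "y @ tl z = b" using y z sorted_filter_append assms(1) by (simp add: run_def)
    obtain x b' where xb: "b = x # b'" using assms(1) by (cases b) (auto simp: run_def)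
    have "y \<noteq> []" "hd y = hd b" using y a xb by auto
    moreover have "last b \<in> set (filter (\<lambda>x. a < x) b)"
      using assms(1,3) a by (auto simp: run_def descent_link_def)
    then have "2 \<le> length z" using z by (cases "filter (\<lambda>x. a < x) b") auto
    moreover have "last y \<le> a" using last_in_set[OF \<open>y \<noteq> []\<close>] y by auto
    moreover have "mset y + mset (filter (\<lambda>x. a < x) b) = mset b"
      using b z by (metis list.sel(3) mset_append)
    ultimately show ?thesis using b assms(1) a y z
      by (auto simp: run_def valley_link_def to_descent_def descent_link_def sorted_wrt_filter)
  qed
  then show "run y" "run z" "valley_link y z" "hd y = hd b" "hd z = hd c"
    "mset y + mset z = mset b + mset c" "to_descent y z = (b, c)" by auto
qed

text \<open>In the changed case \<open>hd y \<le> hd z\<close>, so the valley link must come from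
  the length of \<open>z\<close>. The nonempty tail of \<open>z\<close> ends up at the end of
  \<open>b\<close>, above \<open>hd c\<close>, which is the required descent.\<close>

lemma to_descent:
  assumes "run y" "run z" "valley_link y z" "to_descent y z = (b, c)"
  shows "run b" "run c" "descent_link b c" "hd b = hd y" "hd c = hd z"
    "mset b + mset c = mset y + mset z" "to_valley b c = (y, z)"
proof -
  have "run b \<and> run c \<and> descent_link b c \<and> hd b = hd y \<and> hd c = hd z \<and>
    mset b + mset c = mset y + mset z \<and> to_valley b c = (y, z)"
  proof (cases "descent_link y z")
    case True
    then show ?thesis using assms by (auto simp: to_valley_def to_descent_def)
  next
    case False
    have ne: "y \<noteq> []" using assms(1) by (simp add: run_def)
    obtain a z' where z: "z = a # z'" using assms(2) by (cases z) (auto simp: run_def)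
    have le: "x \<le> a" if "x \<in> set y" for x
      using run_last_ge[OF assms(1) that] False z by (simp add: descent_link_def)
    have gt: "a < x" if "x \<in> set z'" for x using that assms(2) z by (auto simp: run_def)
    have "hd y \<le> a" using le ne by simp
    then have "z' \<noteq> []" using assms(3) z by (auto simp: valley_link_def)
    have b: "b = y @ z'" "c = [a]" using assms(4) False z by (auto simp: to_descent_def)
    have "run b" using assms(1,2) z le gt unfolding b(1) by (fastforce simp: run_def sorted_wrt_append)
    moreover have "filter (\<lambda>x. x \<le> a) b = y" "filter (\<lambda>x. a < x) b = z'"
      using le gt unfolding b(1)
      by (auto simp: filter_empty_conv filter_id_conv not_le not_less)
    moreover have "run c" "descent_link b c"
      using \<open>z' \<noteq> []\<close> b assms(2) gt z by (auto simp: run_def descent_link_def)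
    moreover have "hd b = hd y" "\<not> valley_link b c"
      using ne b \<open>hd y \<le> a\<close> by (auto simp: valley_link_def)
    ultimately show ?thesis using b z by (simp add: to_valley_def)
  qed
  then show "run b" "run c" "descent_link b c" "hd b = hd y" "hd c = hd z"
    "mset b + mset c = mset y + mset z" "to_valley b c = (y, z)" by auto
qed

section \<open>The exchange along a whole list of runs\<close>

fun relink :: "(nat list \<times> bool) list \<Rightarrow> (nat list \<times> bool) list" where
  "relink [] = []"
| "relink ((b, f) # rs) = (case relink rs of
     (w, g) # rs' \<Rightarrow> if f then (fst (to_valley b w), f) # (snd (to_valley b w), g) # rs'
                        else (b, f) # (w, g) # rs'
   | [] \<Rightarrow> [(b, f)])"

lemma map_snd_relink: "map snd (relink rs) = map snd rs"
proof (induction rs rule: relink.induct)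
  case (2 b f rs)
  then show ?case by (cases "relink rs"; cases rs) (auto split: prod.splits)
qed simp

lemma length_relink: "length (relink rs) = length rs"
  using map_snd_relink by (metis length_map)

lemma filter_relink: "length (filter snd (relink rs)) = length (filter snd rs)"
proof -
  have *: "length (filter snd qs) = length (filter id (map snd qs))" for qs :: "(nat list \<times> bool) list"
    by (simp add: filter_map)
  show ?thesis using *[of rs] *[of "relink rs"] map_snd_relink[of rs] by metis
qed

text \<open>The tail is relinked first, so \<open>to_valley\<close> meets the head \<open>w\<close>
  of the relinked tail instead of the original next run. The conjunct on first letters closes the
  induction: \<open>descent_link b w\<close> depends on \<open>w\<close> only through
  \<open>hd w\<close>, and so does the valley link from \<open>w\<close> to its successor, which
  therefore survives the change of \<open>w\<close> into \<open>z\<close>.\<close>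

lemma linked_relink:
  assumes "linked descent_link rs"
  shows "linked valley_link (relink rs) \<and> mset (concat (map fst (relink rs))) = mset (concat (map fst rs)) \<and>
    (rs \<noteq> [] \<longrightarrow> relink rs \<noteq> [] \<and> hd (fst (hd (relink rs))) = hd (fst (hd rs)))"
  using assms
proof (induction rs rule: relink.induct)
  case (2 b f rs)
  then have IH: "linked valley_link (relink rs)" "mset (concat (map fst (relink rs))) = mset (concat (map fst rs))"
    "rs \<noteq> [] \<Longrightarrow> relink rs \<noteq> [] \<and> hd (fst (hd (relink rs))) = hd (fst (hd rs))" and b: "run b"
    by auto
  show ?case
  proof (cases "relink rs")
    case Nil
    then show ?thesis using 2 length_relink[of rs] by auto
  next
    case (Cons r' rs')
    obtain w g where r': "r' = (w, g)" by fastforce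
    show ?thesis
    proof (cases f)
      case False
      then show ?thesis using 2 IH Cons r' b by auto
    next
      case True
      have ne: "rs \<noteq> []" and "hd w = hd (fst (hd rs))" "run w" using IH Cons r' "2.prems" True by auto
      then have "descent_link b w" using "2.prems" True by (simp add: descent_link_def)
      moreover obtain y z where yz: "to_valley b w = (y, z)" by fastforce
      ultimately have tv: "run y" "run z" "valley_link y z" "hd y = hd b" "hd z = hd w"
          "mset y + mset z = mset b + mset w"
        using to_valley[OF b \<open>run w\<close>] by auto
      have "linked valley_link ((z, g) # rs')"
        using IH(1) tv Cons r' by (auto simp: valley_link_def)
      moreover have "mset y + (mset z + mset (concat (map fst rs'))) =
          mset b + mset (concat (map fst rs))"
        using tv(6) IH(2) Cons r' by (simp flip: add.assoc)
      ultimately show ?thesis using IH Cons r' True yz tv by auto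
    qed
  qed
qed simp

text \<open>Flags and lengths survive \<open>relink\<close>, so two lists with the same image are
  compared run by run. At a flag, \<open>to_descent\<close> recovers the first run and the head of
  the relinked tail from the image, and the induction hypothesis applies to the tails.\<close>

lemma inj_on_relink: "inj_on relink {rs. linked descent_link rs}"
proof (rule inj_onI, simp)
  fix rs qs
  assume "linked descent_link rs" "linked descent_link qs" "relink rs = relink qs"
  then show "rs = qs"
  proof (induction rs arbitrary: qs rule: relink.induct)
    case 1
    then show ?case using length_relink[of qs] by simp
  next
    case (2 b f rs)
    obtain b' f' qs' where qs: "qs = (b', f') # qs'"
      using 2 length_relink[of qs] length_relink[of "(b, f) # rs"] by (cases qs) auto
    have f: "f' = f"
      using map_snd_relink[of qs] map_snd_relink[of "(b, f) # rs"] 2(4) qs by simp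
    have len: "length qs' = length rs"
      using length_relink[of qs] length_relink[of "(b, f) # rs"] 2(4) qs by simp
    show ?case
    proof (cases "relink rs")
      case Nil
      then have "rs = []" "qs' = []" using length_relink[of rs] len by auto
      then show ?thesis using 2 qs f by simp
    next
      case (Cons r1 rs1)
      obtain w g where r1: "r1 = (w, g)" by fastforce
      obtain w' g' qs1 where q1: "relink qs' = (w', g') # qs1"
        using length_relink[of qs'] length_relink[of rs] len Cons by (cases "relink qs'") auto
      show ?thesis
      proof (cases f)
        case False
        then have "relink rs = relink qs'" "b' = b" using 2(4) qs f r1 q1 Cons by simp_all
        then show ?thesis using 2(1)[of qs'] 2(2,3) qs f by simp
      next
        case True
        obtain y z where yz: "to_valley b w = (y, z)" by fastforce
        have yz': "to_valley b' w' = (y, z)" and rest: "g' = g" "qs1 = rs1"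
          using 2(4) qs f True r1 q1 Cons yz by (auto simp: prod_eq_iff)
        \<comment> \<open>The hypotheses of \<open>to_valley\<close> for the pair that was actually
          exchanged: relinking the tail keeps its first letter, hence the descent.\<close>
        have *: "run c \<and> run v \<and> descent_link c v"
          if "linked descent_link ((c, True) # ps)" "relink ps = (v, h) # ps1" for c v ps h ps1
          using that linked_relink[of ps] by (auto simp: descent_link_def)
        have "to_descent y z = (b, w)" "to_descent y z = (b', w')"
          using to_valley(7) yz yz' *[of b rs w g rs1] *[of b' qs' w' g' qs1] 2(2,3) qs f True r1 q1 Cons by auto
        then have "b' = b" "relink rs = relink qs'" using r1 q1 Cons rest by auto
        then show ?thesis using 2(1)[of qs'] 2(2,3) qs f by simp
      qed
    qed
  qed
qed

text \<open>The preimage is built from left to right: undo the exchange on the first two runs, then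
  treat the tail with \<open>c\<close> in place of \<open>z\<close>. This tail is a new list, hence
  the induction on length.\<close>

lemma surj_relink: "linked valley_link rs \<Longrightarrow> \<exists>qs. linked descent_link qs \<and> relink qs = rs"
proof (induction rs rule: length_induct)
  case (1 rs)
  show ?case
  proof (cases rs)
    case Nil
    then show ?thesis by (intro exI[of _ "[]"]) simp
  next
    case (Cons r rs')
    obtain y f where r: "r = (y, f)" by fastforce
    show ?thesis
    proof (cases rs')
      case Nil
      then show ?thesis using 1 Cons r by (intro exI[of _ rs]) auto
    next
      case (Cons s rs1)
      obtain z g where s: "s = (z, g)" by fastforce
      note rs = \<open>rs = r # rs'\<close>[unfolded r Cons s]
      have lk: "run y" "run z" "linked valley_link ((z, g) # rs1)" "f \<Longrightarrow> valley_link y z"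
        using 1(2) rs by auto
      show ?thesis
      proof (cases f)
        case False
        have "length ((z, g) # rs1) < length rs" using rs by simp
        then obtain qs where "linked descent_link qs" "relink qs = (z, g) # rs1"
          using 1(1) lk(3) by blast
        then show ?thesis using rs lk False by (intro exI[of _ "(y, f) # qs"]) auto
      next
        case True
        obtain b c where bc: "to_descent y z = (b, c)" by fastforce
        note td = to_descent[OF lk(1,2) lk(4)[OF True] bc]
        have "linked valley_link ((c, g) # rs1)" using lk(3) td by (auto simp: valley_link_def)
        moreover have "length ((c, g) # rs1) < length rs" using rs by simp
        ultimately obtain qs where qs: "linked descent_link qs" "relink qs = (c, g) # rs1"
          using 1(1) by blast
        have "qs \<noteq> []" using qs(2) by auto
        \<comment> \<open>The first run of \<open>qs\<close> may differ from \<open>c\<close>, but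
          it has the same first letter, which is all that \<open>descent_link b\<close>
          sees.\<close>
        then have "hd (fst (hd qs)) = hd c" using linked_relink[OF qs(1)] qs(2) by simp
        then have "linked descent_link ((b, f) # qs)"
          using qs td \<open>qs \<noteq> []\<close> by (simp add: descent_link_def)
        moreover have "relink ((b, f) # qs) = rs" using qs(2) td(7) True rs by simp
        ultimately show ?thesis by blast
      qed
    qed
  qed
qed

lemma bij_betw_relink: "bij_betw relink (run_lists descent_link \<mu> k l) (run_lists valley_link \<mu> k l)"
proof -
  have len: "length (concat (map fst (relink rs))) = length (concat (map fst rs))"
    if "linked descent_link rs" for rs
    using linked_relink[OF that] by (metis size_mset)
  have "inj_on relink (run_lists descent_link \<mu> k l)"
    using inj_on_relink by (rule inj_on_subset) (auto simp: run_lists_def)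
  moreover have "relink rs \<in> run_lists valley_link \<mu> k l" if "rs \<in> run_lists descent_link \<mu> k l" for rs
    using that linked_relink[of rs] by (simp add: run_lists_def filter_relink length_relink len)
  moreover have "rs \<in> relink ` run_lists descent_link \<mu> k l" if "rs \<in> run_lists valley_link \<mu> k l" for rs
  proof -
    have "linked valley_link rs" using that by (simp add: run_lists_def)
    then obtain qs where qs: "linked descent_link qs" "relink qs = rs"
      using surj_relink by blast
    then have "qs \<in> run_lists descent_link \<mu> k l"
      using that linked_relink[of qs] filter_relink[of qs] length_relink[of qs] len[of qs]
      by (simp add: run_lists_def)
    then show ?thesis using qs(2) by blast
  qed
  ultimately show ?thesis unfolding bij_betw_def by blast
qed


section \<open>Smirnov words and their increasing runs\<close>

text \<open>One count for ascents and descents, so that the recursion along a word is proved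
  once.\<close>

definition adjacent :: "(nat \<Rightarrow> nat \<Rightarrow> bool) \<Rightarrow> nat list \<Rightarrow> nat" where
  "adjacent P w = card {i. Suc i < length w \<and> P (w ! i) (w ! Suc i)}"

lemma adjacent_Nil [simp]: "adjacent P [] = 0"
  by (simp add: adjacent_def)

lemma adjacent_single [simp]: "adjacent P [a] = 0"
  by (simp add: adjacent_def)

lemma adjacent_Cons [simp]: "adjacent P (a # b # w) = of_bool (P a b) + adjacent P (b # w)"
proof -
  let ?S = "{i. Suc i < length (b # w) \<and> P ((b # w) ! i) ((b # w) ! Suc i)}"
  have fin: "finite ?S" by simp
  have "{i. Suc i < length (a # b # w) \<and> P ((a # b # w) ! i) ((a # b # w) ! Suc i)} =
      (if P a b then {0} else {}) \<union> Suc ` ?S"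
  proof (rule set_eqI)
    fix i show "(i \<in> {i. Suc i < length (a # b # w) \<and> P ((a # b # w) ! i) ((a # b # w) ! Suc i)}) =
      (i \<in> (if P a b then {0} else {}) \<union> Suc ` ?S)"
      by (cases i) auto
  qed
  then show ?thesis using fin unfolding adjacent_def
    by (simp add: card_insert_if card_image)
qed

lemma ascents_adjacent: "ascents ws = (\<Sum>b\<leftarrow>ws. adjacent (<) b)"
  by (simp add: ascents_def adjacent_def)

lemma descents_adjacent: "descents ws = (\<Sum>b\<leftarrow>ws. adjacent (>) b)"
  by (simp add: descents_def adjacent_def)

lemma smirnov_Nil [simp]: "smirnov []"
  by (simp add: smirnov_def)

lemma smirnov_Cons [simp]:
  "smirnov (a # w) \<longleftrightarrow> 0 < a \<and> (w \<noteq> [] \<longrightarrow> a \<noteq> hd w) \<and> smirnov w"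
proof (cases w)
  case (Cons b v)
  have "(\<forall>i. Suc i < length (a # w) \<longrightarrow> (a # w) ! i \<noteq> (a # w) ! Suc i) \<longleftrightarrow>
    a \<noteq> b \<and> (\<forall>i. Suc i < length w \<longrightarrow> w ! i \<noteq> w ! Suc i)" (is "?L \<longleftrightarrow> ?R")
  proof
    show "?L \<Longrightarrow> ?R" using Cons by (metis Suc_less_eq length_Cons nth_Cons_0 nth_Cons_Suc zero_less_Suc)
    show "?R \<Longrightarrow> ?L" using Cons by (auto simp: nth_Cons split: nat.splits)
  qed
  then show ?thesis using Cons unfolding smirnov_def by auto
qed (simp add: smirnov_def)

text \<open>Neighbouring letters differ, so each of the \<open>length w - 1\<close> neighbouring
  pairs is either an ascent or a descent.\<close>

lemma adjacent_smirnov: "smirnov w \<Longrightarrow> w \<noteq> [] \<Longrightarrow> adjacent (<) w + adjacent (>) w + 1 = length w"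
  by (induction w rule: induct_list012) auto

text \<open>Ascents are determined by the length, the number of blocks and the descents, so the
  constructions below only keep track of these.\<close>

lemma length_segmented_smirnov:
  "segmented_smirnov ws \<Longrightarrow> ascents ws + descents ws + length ws = length (concat ws)"
  unfolding ascents_adjacent descents_adjacent
proof (induction ws)
  case (Cons w ws)
  then show ?case using adjacent_smirnov[of w] by (simp add: segmented_smirnov_def)
qed simp

lemma adjacent_eq_0: "smirnov w \<Longrightarrow> adjacent (>) w = 0 \<Longrightarrow> sorted_wrt (<) w"
  "smirnov w \<Longrightarrow> adjacent (<) w = 0 \<Longrightarrow> sorted_wrt (>) w"
  by (induction w rule: induct_list012) (auto split: if_splits)

lemma sorted_wrt_adjacent:
  assumes "\<And>a b. P a b \<Longrightarrow> \<not> Q a b"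
  shows "sorted_wrt P w \<Longrightarrow> adjacent Q w = 0"
  using assms by (induction w rule: induct_list012) auto

section \<open>Cutting words at their descents and gluing the runs back\<close>

fun runs_of_words :: "nat list list \<Rightarrow> (nat list \<times> bool) list" where
  "runs_of_words [] = []"
| "runs_of_words ([] # ws) = runs_of_words ws"
| "runs_of_words ([a] # ws) = ([a], False) # runs_of_words ws"
| "runs_of_words ((a # b # w) # ws) =
     (if a < b then (a # fst (hd (runs_of_words ((b # w) # ws))), snd (hd (runs_of_words ((b # w) # ws))))
                    # tl (runs_of_words ((b # w) # ws))
      else ([a], True) # runs_of_words ((b # w) # ws))"

text \<open>The flags carry the block structure: \<open>False\<close> marks the last run of a block,
  so the cutting can be undone.\<close>

fun words_of_runs :: "(nat list \<times> bool) list \<Rightarrow> nat list list" where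
  "words_of_runs [] = []"
| "words_of_runs ((b, f) # rs) =
     (if f then (b @ hd (words_of_runs rs)) # tl (words_of_runs rs) else b # words_of_runs rs)"

text \<open>Ensures that \<open>hd\<close> and \<open>tl\<close> in the recursion of
  \<open>runs_of_words\<close> meet a nonempty list, and exposes the letter to which a preceding
  letter is compared.\<close>

lemma hd_runs_of_words:
  "segmented_smirnov ((a # w) # ws) \<Longrightarrow>
    \<exists>b f rs. runs_of_words ((a # w) # ws) = (a # b, f) # rs"
proof (induction w arbitrary: a)
  case (Cons b w)
  then have "segmented_smirnov ((b # w) # ws)" by (simp add: segmented_smirnov_def)
  then show ?case using Cons.IH[of b] by auto
qed auto

text \<open>Every descent adds one flag and one run; without descents there is one run per
  block.\<close>

lemma runs_of_words:
  assumes "segmented_smirnov ws"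
  shows "linked descent_link (runs_of_words ws) \<and>
    concat (map fst (runs_of_words ws)) = concat ws \<and>
    length (filter snd (runs_of_words ws)) = descents ws \<and>
    length (runs_of_words ws) = length ws + descents ws \<and>
    words_of_runs (runs_of_words ws) = ws"
  using assms unfolding descents_adjacent
proof (induction ws rule: runs_of_words.induct)
  case (3 a ws)
  then show ?case by (auto simp: segmented_smirnov_def run_def)
next
  case (4 a b w ws)
  have seg: "segmented_smirnov ((b # w) # ws)" and ab: "a \<noteq> b" "0 < a"
    using 4 by (auto simp: segmented_smirnov_def)
  obtain c f rs where rs: "runs_of_words ((b # w) # ws) = (b # c, f) # rs"
    using hd_runs_of_words[OF seg] by blast
  let ?ws = "(b # w) # ws"
  have "linked descent_link (runs_of_words ?ws) \<and>
    concat (map fst (runs_of_words ?ws)) = concat ?ws \<and>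
    length (filter snd (runs_of_words ?ws)) = (\<Sum>b\<leftarrow>?ws. adjacent (>) b) \<and>
    length (runs_of_words ?ws) = length ?ws + (\<Sum>b\<leftarrow>?ws. adjacent (>) b) \<and>
    words_of_runs (runs_of_words ?ws) = ?ws"
    using 4(1,4) seg by blast
  then have IH: "linked descent_link ((b # c, f) # rs)" "(b # c) @ concat (map fst rs) = (b # w) @ concat ws"
    "length (filter snd ((b # c, f) # rs)) = (\<Sum>b\<leftarrow>(b # w) # ws. adjacent (>) b)"
    "length ((b # c, f) # rs) = length ((b # w) # ws) + (\<Sum>b\<leftarrow>(b # w) # ws. adjacent (>) b)"
    "words_of_runs ((b # c, f) # rs) = (b # w) # ws"
    unfolding rs by simp_all
  show ?case
  proof (cases "a < b")
    case True
    have "run (a # b # c)" using IH(1) ab True by (auto simp: run_def)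
    moreover have "words_of_runs ((a # b # c, f) # rs) = (a # b # w) # ws"
      using IH(5) by (cases f) auto
    \<comment> \<open>\<open>descent_link\<close> sees only the last letter of its first argument,
      so prepending \<open>a\<close> keeps the link to the next run.\<close>
    moreover have "descent_link (a # b # c) = descent_link (b # c)" by (auto simp: descent_link_def)
    ultimately show ?thesis using IH True rs by auto
  next
    case False
    then have "descent_link [a] (b # c)" "run [a]" using ab by (auto simp: descent_link_def run_def)
    then show ?thesis using IH rs False ab by auto
  qed
qed (auto simp: segmented_smirnov_def)

text \<open>A run at the start of a block stops at the end of the block or at a descent; in both
  cases it is cut off in one piece. This computes the cutting of a glued list.\<close>

lemma runs_of_words_run:
  assumes "run b"
  shows "runs_of_words (b # ws) = (b, False) # runs_of_words ws"
    "c \<noteq> [] \<Longrightarrow> hd c < last b \<Longrightarrow> runs_of_words ((b @ c) # ws) = (b, True) # runs_of_words (c # ws)"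
  using assms
proof (induction b rule: induct_list012)
  case (2 a)
  { case 2 then show ?case by (cases c) auto }
qed (auto simp: run_def)

lemma smirnov_append:
  assumes "run b" "smirnov c" "c \<noteq> []" "hd c < last b"
  shows "smirnov (b @ c)"
  using assms by (induction b rule: induct_list012) (auto simp: run_def)

lemma run_smirnov: "run b \<Longrightarrow> smirnov b"
  by (induction b rule: induct_list012) (auto simp: run_def)

text \<open>Gluing keeps the first letter, so a flag produces a descent at the seam, and the word is
  cut there again.\<close>

lemma words_of_runs:
  assumes "linked descent_link rs"
  shows "segmented_smirnov (words_of_runs rs) \<and> runs_of_words (words_of_runs rs) = rs \<and>
    (rs \<noteq> [] \<longrightarrow> words_of_runs rs \<noteq> [] \<and> hd (hd (words_of_runs rs)) = hd (fst (hd rs)))"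
  using assms
proof (induction rs)
  case (Cons r rs)
  obtain b f where r: "r = (b, f)" by fastforce
  have b: "run b" "b \<noteq> []" using Cons r by (auto simp: run_def)
  show ?case
  proof (cases f)
    case False
    then show ?thesis using Cons r runs_of_words_run(1) b
      by (auto simp: segmented_smirnov_def run_smirnov)
  next
    case True
    then have rs: "rs \<noteq> []" "hd (fst (hd rs)) < last b" using Cons.prems r by (auto simp: descent_link_def)
    have IH: "segmented_smirnov (words_of_runs rs)" "runs_of_words (words_of_runs rs) = rs"
       "words_of_runs rs \<noteq> []" "hd (hd (words_of_runs rs)) = hd (fst (hd rs))"
      using Cons rs r by auto
    then obtain c ws where c: "words_of_runs rs = c # ws" by (cases "words_of_runs rs") auto
    have "c \<noteq> []" "smirnov c" using IH c by (auto simp: segmented_smirnov_def)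
    then show ?thesis using c IH rs r True b smirnov_append runs_of_words_run(2)[OF b(1)]
      by (auto simp: segmented_smirnov_def)
  qed
qed (simp add: segmented_smirnov_def)

text \<open>There are as many runs as blocks and descents together, so by
  \<open>length_segmented_smirnov\<close> the length exceeds the number of runs by the number of
  ascents.\<close>

lemma bij_betw_runs_of_words: "bij_betw runs_of_words (SW \<mu> k l) (run_lists descent_link \<mu> k l)"
proof (rule bij_betw_byWitness[where f' = words_of_runs])
  have "runs_of_words ws \<in> run_lists descent_link \<mu> k l" if "ws \<in> SW \<mu> k l" for ws
    using that runs_of_words[of ws] length_segmented_smirnov[of ws] by (simp add: SW_def run_lists_def)
  then show "runs_of_words ` SW \<mu> k l \<subseteq> run_lists descent_link \<mu> k l" by blast
  have "words_of_runs rs \<in> SW \<mu> k l" if "rs \<in> run_lists descent_link \<mu> k l" for rs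
    using that words_of_runs[of rs] runs_of_words[of "words_of_runs rs"]
      length_segmented_smirnov[of "words_of_runs rs"] by (simp add: SW_def run_lists_def)
  then show "words_of_runs ` run_lists descent_link \<mu> k l \<subseteq> SW \<mu> k l" by blast
qed (use runs_of_words words_of_runs in \<open>auto simp: SW_def run_lists_def\<close>)


section \<open>Paths of area zero\<close>

definition block :: "nat list \<Rightarrow> path" where
  "block b = map North b @ replicate (length b) East"

text \<open>The first run of the list is the topmost block, in accordance with the reversal in
  \<open>beta_star_path\<close>.\<close>

fun run_path :: "(nat list \<times> bool) list \<Rightarrow> path" where
  "run_path [] = []"
| "run_path ((b, f) # rs) = run_path rs @ block b"

text \<open>\<open>length (run_path rs)\<close> is the position of the first North step of
  \<open>block b\<close>, the only step of the block that can be a valley.\<close>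

fun run_valleys :: "(nat list \<times> bool) list \<Rightarrow> nat set" where
  "run_valleys [] = {}"
| "run_valleys ((b, f) # rs) = (if f then {length (run_path rs)} else {}) \<union> run_valleys rs"

definition path_of_runs :: "(nat list \<times> bool) list \<Rightarrow> decorated_path" where
  "path_of_runs rs = (run_path rs, rises (run_path rs), run_valleys rs)"

lemma is_north_simps [simp]: "is_north (North a)" "\<not> is_north East"
  by (simp_all add: is_north_def)

lemma is_north_iff: "is_north s \<longleftrightarrow> (\<exists>a. s = North a)"
  by (cases s) auto

lemma norths_simps [simp]: "norths [] = 0" "norths (p @ q) = norths p + norths q"
  "norths (map North b) = length b" "norths (replicate m East) = 0"
  by (simp_all add: norths_def filter_map comp_def)

lemma easts_simps [simp]: "easts [] = 0" "easts (p @ q) = easts p + easts q"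
  "easts (map North b) = 0" "easts (replicate m East) = m"
  by (simp_all add: easts_def filter_map comp_def)

lemma labels_simps [simp]: "labels [] = {#}" "labels (p @ q) = labels p + labels q"
  "labels (map North b) = mset b" "labels (replicate m East) = {#}"
proof -
  show "labels (map North b) = mset b" by (induction b) (auto simp: labels_def)
  show "labels (replicate m East) = {#}" by (induction m) (auto simp: labels_def)
qed (simp_all add: labels_def)

lemma length_block [simp]: "length (block b) = 2 * length b"
  by (simp add: block_def)

lemma block_counts [simp]: "norths (block b) = length b" "easts (block b) = length b" "labels (block b) = mset b"
  by (simp_all add: block_def)

lemma nth_block: "i < length b \<Longrightarrow> block b ! i = North (b ! i)"
  "length b \<le> i \<Longrightarrow> i < 2 * length b \<Longrightarrow> block b ! i = East"
  by (simp_all add: block_def nth_append)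

lemma last_block: "b \<noteq> [] \<Longrightarrow> block b \<noteq> [] \<and> last (block b) = East"
  by (cases b) (auto simp: block_def)

text \<open>What area zero demands of the path once every rise is decorated; \<open>mem_LD0\<close>
  makes this precise.\<close>

definition zero_area_path :: "path \<Rightarrow> bool" where
  "zero_area_path p \<longleftrightarrow> labelled_dyck_path p \<and> (\<forall>j \<in> verticals p - rises p. area_word p j = 0)"

text \<open>\<open>successively\<close> splits over appended lists, which suits the decomposition
  into blocks better than a condition on positions.\<close>

lemma labelled_dyck_path_iff:
  "labelled_dyck_path p \<longleftrightarrow> dyck_path p \<and> (\<forall>a \<in># labels p. a > 0) \<and>
    successively (\<lambda>s t. \<forall>a b. s = North a \<longrightarrow> t = North b \<longrightarrow> a < b) p"
  unfolding labelled_dyck_path_def successively_conv_nth by blast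

lemma successively_norths:
  "successively (\<lambda>s t. \<forall>a b. s = North a \<longrightarrow> t = North b \<longrightarrow> a < b) (map North b) \<longleftrightarrow> sorted_wrt (<) b"
  by (simp add: successively_map successively_conv_sorted_wrt)

section \<open>Appending a block to a path that ends on the diagonal\<close>

lemma take_block_counts:
  "easts (take i (block b)) \<le> norths (take i (block b))"
proof -
  have "take i (block b) = map North (take i b) @ replicate (min (i - length b) (length b)) East"
    by (simp add: block_def take_map)
  then show ?thesis by simp
qed

lemma dyck_path_append:
  assumes "norths p = easts p"
  shows "dyck_path (p @ block b) \<longleftrightarrow> dyck_path p"
proof
  assume d: "dyck_path (p @ block b)"
  have "easts (take j p) \<le> norths (take j p)" if "j \<le> length p" for j
    using d that unfolding dyck_path_def by (auto dest!: spec[of _ j])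
  then show "dyck_path p" using assms by (simp add: dyck_path_def)
next
  assume d: "dyck_path p"
  have "easts (take j (p @ block b)) \<le> norths (take j (p @ block b))" for j
  proof (cases "j \<le> length p")
    case True
    then show ?thesis using d by (simp add: dyck_path_def)
  next
    case False
    then show ?thesis using assms take_block_counts[of "j - length p" b] by simp
  qed
  then show "dyck_path (p @ block b)" using assms by (simp add: dyck_path_def)
qed

lemma verticals_append: "verticals (p @ block b) = verticals p \<union> {length p..<length p + length b}"
proof (rule set_eqI)
  fix j
  show "j \<in> verticals (p @ block b) \<longleftrightarrow> j \<in> verticals p \<union> {length p..<length p + length b}"
    using nth_block[where i = "j - length p" and b = b]
    by (cases "j < length p"; cases "j < length p + length b") (auto simp: verticals_def nth_append)
qed

text \<open>The step before the block is an East step or absent, so the lowest step of the block is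
  no rise; hence the interval is open on the left.\<close>

lemma rises_append:
  assumes "p = [] \<or> last p = East"
  shows "rises (p @ block b) = rises p \<union> {length p<..<length p + length b}"
proof (rule set_eqI)
  fix j
  show "j \<in> rises (p @ block b) \<longleftrightarrow> j \<in> rises p \<union> {length p<..<length p + length b}"
  proof (cases "j \<le> length p")
    case True
    moreover have "is_north ((p @ block b) ! (j - 1)) = is_north (p ! (j - 1))" if "j \<ge> 1"
      using True that by (auto simp: nth_append)
    moreover have "\<not> is_north (p ! (length p - 1))" if "Suc 0 \<le> length p"
      using that assms last_conv_nth[of p] by (cases "p = []") auto
    ultimately show ?thesis
      by (cases "j = length p") (auto simp: rises_def verticals_append)
  next
    case False
    then have "j \<notin> verticals p" "j \<notin> rises p" by (auto simp: verticals_def rises_def)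
    moreover have "is_north ((p @ block b) ! (j - 1))" if "j < length p + length b"
      using that False nth_block(1)[where i = "j - 1 - length p" and b = b] by (auto simp: nth_append)
    ultimately show ?thesis using False by (auto simp: rises_def verticals_append)
  qed
qed

lemma area_word_append: "j \<le> length p \<Longrightarrow> area_word (p @ q) j = area_word p j"
  by (simp add: area_word_def)

text \<open>The lower path ends on the diagonal, so the only new vertical step that is not a rise
  has entry \<open>0\<close> in the area word. The East step in between separates the labels of
  \<open>b\<close> from those of \<open>p\<close>.\<close>

lemma zero_area_path_append:
  assumes "p = [] \<or> last p = East" "norths p = easts p" "b \<noteq> []"
  shows "zero_area_path (p @ block b) \<longleftrightarrow> zero_area_path p \<and> run b"
proof -
  have "labelled_dyck_path (p @ block b) \<longleftrightarrow> labelled_dyck_path p \<and> run b"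
  proof -
    let ?P = "\<lambda>s t. \<forall>a b. s = North a \<longrightarrow> t = North b \<longrightarrow> a < (b::nat)"
    have "successively ?P (block b) \<longleftrightarrow> sorted_wrt (<) b"
    proof -
      have "successively ?P (replicate m East)" for m by (simp add: successively_conv_nth)
      then show ?thesis unfolding block_def successively_append_iff using successively_norths by auto
    qed
    then show ?thesis
      unfolding labelled_dyck_path_iff successively_append_iff dyck_path_append[OF assms(2)] run_def
      using assms by auto
  qed
  moreover have "verticals (p @ block b) - rises (p @ block b) = insert (length p) (verticals p - rises p)"
  proof -
    have "verticals p \<subseteq> {..<length p}" "rises p \<subseteq> verticals p"
      by (auto simp: verticals_def rises_def)
    then show ?thesis using assms(3) unfolding verticals_append rises_append[OF assms(1)] by auto
  qed
  moreover have "area_word (p @ block b) j = area_word p j" if "j \<in> verticals p" for j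
    using that by (simp add: area_word_append verticals_def)
  moreover have "area_word (p @ block b) (length p) = 0"
    using assms(2) by (simp add: area_word_def)
  ultimately show ?thesis unfolding zero_area_path_def by auto
qed

section \<open>Decomposition of paths of area zero\<close>

lemma ex_maximal_suffix:
  "\<exists>q ys. p = q @ ys \<and> (\<forall>y \<in> set ys. P y) \<and> (q = [] \<or> \<not> P (last q))"
proof (induction p rule: rev_induct)
  case (snoc x p)
  then obtain q ys where p: "p = q @ ys" "\<forall>y \<in> set ys. P y" "q = [] \<or> \<not> P (last q)" by blast
  show ?case
  proof (cases "P x")
    case True
    then show ?thesis using p by (intro exI[of _ q] exI[of _ "ys @ [x]"]) auto
  next
    case False
    then show ?thesis by (intro exI[of _ "p @ [x]"] exI[of _ "[]"]) auto
  qed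
qed simp

text \<open>Strip the final East steps and then the North steps before them. The lowest of these
  North steps is not a rise, so it starts on the diagonal, and the two stripped runs have equal
  length.\<close>

lemma zero_area_path_split:
  assumes "zero_area_path p" "p \<noteq> []"
  obtains q b where "p = q @ block b" "run b" "q = [] \<or> last q = East" "zero_area_path q" "norths q = easts q"
proof -
  have dyck: "norths p = easts p" "j \<le> length p \<Longrightarrow> easts (take j p) \<le> norths (take j p)" for j
    using assms by (auto simp: zero_area_path_def labelled_dyck_path_def dyck_path_def)
  obtain p' ys where p': "p = p' @ ys" "\<forall>y \<in> set ys. y = East" "p' = [] \<or> last p' \<noteq> East"
    using ex_maximal_suffix[of p "\<lambda>y. y = East"] by blast
  obtain m where ys: "ys = replicate m East" using p'(2) by (metis replicate_length_same)
  obtain q zs where q: "p' = q @ zs" "\<forall>y \<in> set zs. is_north y" "q = [] \<or> \<not> is_north (last q)"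
    using ex_maximal_suffix[of p' is_north] by blast
  have qE: "q = [] \<or> last q = East" using q(3) by (simp add: is_north_def)
  obtain b where zs: "zs = map North b" using q(2) by (metis is_north_iff ex_map_conv)
  have p: "p = q @ map North b @ replicate m East" using p' q ys zs by simp
  \<comment> \<open>Otherwise \<open>p'\<close> equals \<open>q\<close>; by maximality of the two
    suffixes it is then empty, and \<open>p\<close> consists of East steps only.\<close>
  have "b \<noteq> []"
  proof
    assume "b = []"
    then have "p' = []" using p'(3) qE q(1) zs by auto
    then show False using dyck(1) p' ys assms(2) by simp
  qed
  have "length q \<in> verticals p - rises p"
    using \<open>b \<noteq> []\<close> qE last_conv_nth[of q] unfolding p verticals_def rises_def
    by (cases "q = []") (auto simp: nth_append)
  then have "area_word p (length q) = 0" using assms(1) by (simp add: zero_area_path_def)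
  \<comment> \<open>The subtraction in \<open>area_word\<close> truncates, so entry \<open>0\<close>
    gives only this inequality; the Dyck condition gives the other one.\<close>
  then have "norths q \<le> easts q" by (simp add: area_word_def p)
  then have eq: "norths q = easts q" using dyck(2)[of "length q"] p by simp
  then have "m = length b" using dyck(1) p by simp
  then have "p = q @ block b" using p by (simp add: block_def)
  then show thesis using that zero_area_path_append[OF qE eq \<open>b \<noteq> []\<close>] assms(1) qE eq by blast
qed

text \<open>A rise follows a North step that starts weakly above the diagonal, so its entry in the
  area word is positive. Area \<open>0\<close> thus forces every rise to be decorated, and only the
  choice of valleys remains free.\<close>

lemma mem_LD0:
  "(p, R, V) \<in> LD0 \<mu> k l \<longleftrightarrow> zero_area_path p \<and> has_content (labels p) \<mu> \<and> R = rises p \<and> card (rises p) = k \<and>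
     V \<subseteq> contractible_valleys p \<and> card V = l"
proof -
  have fin: "finite (verticals p - R)" by (simp add: verticals_def)
  have pos: "area_word p j \<noteq> 0" if "j \<in> rises p" "dyck_path p" for j
  proof -
    note j = that(1)
    have "easts (take (j - 1) p) \<le> norths (take (j - 1) p)"
      using that by (auto simp: rises_def verticals_def dyck_path_def)
    moreover have "take j p = take (j - 1) p @ [p ! (j - 1)]"
      using j by (cases j) (auto simp: rises_def verticals_def take_Suc_conv_app_nth)
    moreover have "norths [p ! (j - 1)] = 1" "easts [p ! (j - 1)] = 0"
      using j by (auto simp: rises_def norths_def easts_def is_north_def)
    ultimately show ?thesis by (simp add: area_word_def)
  qed
  have "(\<forall>j \<in> verticals p - R. area_word p j = 0) \<longleftrightarrow>
      (\<forall>j \<in> verticals p - rises p. area_word p j = 0) \<and> R = rises p"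
    if "dyck_path p" "R \<subseteq> rises p"
  proof -
    have "rises p \<subseteq> verticals p" by (auto simp: rises_def)
    then show ?thesis using pos that by blast
  qed
  then show ?thesis
    using fin unfolding LD0_def LD_def area_def zero_area_path_def labelled_dyck_path_def by auto
qed

text \<open>All North steps of the block after the first are rises, so only position
  \<open>length p\<close> can be a new valley, and its contractibility is decided by the end of
  \<open>p\<close> and the label \<open>hd b\<close>.\<close>

lemma contractible_valleys_append:
  assumes "p = [] \<or> last p = East" "b \<noteq> []"
  shows "contractible_valleys (p @ block b) = contractible_valleys p \<union>
    (if 2 \<le> length p \<and> (p ! (length p - 2) = East \<or> (\<exists>a < hd b. p ! (length p - 2) = North a))
     then {length p} else {})" (is "_ = _ \<union> ?C")
proof (rule set_eqI)
  fix j
  consider "j < length p" | "j = length p" | "length p < j" by linarith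
  then show "j \<in> contractible_valleys (p @ block b) \<longleftrightarrow> j \<in> contractible_valleys p \<union> ?C"
  proof cases
    case 1
    then show ?thesis
      by (auto simp: contractible_valleys_def valleys_def verticals_def nth_append)
  next
    case 2
    have "p ! (length p - Suc 0) = East" if "2 \<le> length p"
      using that assms(1) last_conv_nth[of p] by (cases "p = []") auto
    moreover have "block b ! 0 = North (hd b)"
      using assms(2) nth_block(1)[where i = 0 and b = b] by (simp add: hd_conv_nth)
    ultimately show ?thesis using 2 assms(2)
      by (auto simp: contractible_valleys_def valleys_def verticals_def nth_append)
  next
    case 3
    have "j \<in> rises (p @ block b)" if "j \<in> verticals (p @ block b)"
      using that 3 unfolding verticals_append rises_append[OF assms(1)] by (auto simp: verticals_def)
    then show ?thesis using 3
      by (auto simp: contractible_valleys_def valleys_def verticals_def rises_def)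
  qed
qed

lemma contractible_valleys_block:
  assumes "b \<noteq> []" "c \<noteq> []"
  shows "length p + 2 * length c \<in> contractible_valleys ((p @ block c) @ block b) \<longleftrightarrow> valley_link b c"
proof -
  let ?p = "p @ block c"
  have len: "length ?p - 2 = length p + (2 * length c - 2)" "2 \<le> length ?p"
    using assms(2) by (cases c; simp)+
  have "?p ! (length ?p - 2) = (if 2 \<le> length c then East else North (hd c))"
  proof (cases "2 \<le> length c")
    case True
    then show ?thesis using len nth_block(2)[where i = "2 * length c - 2" and b = c] by (auto simp: nth_append)
  next
    case False
    then show ?thesis using len assms(2) nth_block(1)[where i = 0 and b = c]
      by (cases c) (auto simp: nth_append not_le less_Suc_eq)
  qed
  moreover have "length ?p \<notin> contractible_valleys ?p"
    by (simp add: contractible_valleys_def valleys_def verticals_def)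
  moreover have "last ?p = East" using last_block[OF assms(2)] by simp
  ultimately show ?thesis using assms len(2) contractible_valleys_append[of ?p b]
    by (auto simp: valley_link_def)
qed

text \<open>One induction for all facts, because appending a block requires that the lower path ends
  on the diagonal with an East step. A block of \<open>m\<close> letters adds \<open>m - 1\<close>
  rises.\<close>

lemma run_path:
  assumes "linked P rs"
  shows "norths (run_path rs) = easts (run_path rs)" "run_path rs = [] \<or> last (run_path rs) = East"
    "run_path rs = [] \<longleftrightarrow> rs = []"
    "zero_area_path (run_path rs)" "labels (run_path rs) = mset (concat (map fst rs))"
    "card (rises (run_path rs)) + length rs = length (concat (map fst rs))"
    "run_valleys rs \<subseteq> {..<length (run_path rs)}" "card (run_valleys rs) = length (filter snd rs)"
proof -
  have "norths (run_path rs) = easts (run_path rs) \<and> (run_path rs = [] \<or> last (run_path rs) = East) \<and>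
    (run_path rs = [] \<longleftrightarrow> rs = []) \<and>
    zero_area_path (run_path rs) \<and> labels (run_path rs) = mset (concat (map fst rs)) \<and>
    card (rises (run_path rs)) + length rs = length (concat (map fst rs)) \<and>
    run_valleys rs \<subseteq> {..<length (run_path rs)} \<and> card (run_valleys rs) = length (filter snd rs)"
    using assms
  proof (induction rs)
    case Nil
    have "rises [] = {}" by (simp add: rises_def verticals_def)
    moreover have "zero_area_path []" by (simp add: zero_area_path_def labelled_dyck_path_def dyck_path_def verticals_def)
    ultimately show ?case by simp
  next
    case (Cons r rs)
    obtain b f where r: "r = (b, f)" by fastforce
    have b: "run b" "b \<noteq> []" using Cons r by (auto simp: run_def)
    have IH: "norths (run_path rs) = easts (run_path rs)" "run_path rs = [] \<or> last (run_path rs) = East"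
      "zero_area_path (run_path rs)" "labels (run_path rs) = mset (concat (map fst rs))"
      "card (rises (run_path rs)) + length rs = length (concat (map fst rs))"
      "run_valleys rs \<subseteq> {..<length (run_path rs)}" "card (run_valleys rs) = length (filter snd rs)"
      using Cons r by auto
    have sub: "rises (run_path rs) \<subseteq> {..<length (run_path rs)}" by (auto simp: rises_def verticals_def)
    then have "card (rises (run_path rs @ block b)) = card (rises (run_path rs)) + (length b - 1)"
      unfolding rises_append[OF IH(2)]
      by (subst card_Un_disjoint) (auto intro: finite_subset)
    moreover have "run_valleys (r # rs) \<subseteq> {..<length (run_path (r # rs))}"
      using IH(6) b r by (auto simp: subset_iff intro: less_le_trans)
    moreover have "card (run_valleys (r # rs)) = length (filter snd (r # rs))"
    proof -
      have "finite (run_valleys rs)" using IH(6) finite_subset by blast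
      moreover have "length (run_path rs) \<notin> run_valleys rs" using IH(6) by auto
      ultimately show ?thesis using IH(7) r by simp
    qed
    moreover have "length b \<ge> 1" using b by (cases b) auto
    ultimately show ?case using IH b r last_block[OF b(2)] by (simp add: zero_area_path_append add.commute)
  qed
  then show "norths (run_path rs) = easts (run_path rs)" "run_path rs = [] \<or> last (run_path rs) = East"
    "run_path rs = [] \<longleftrightarrow> rs = []"
    "zero_area_path (run_path rs)" "labels (run_path rs) = mset (concat (map fst rs))"
    "card (rises (run_path rs)) + length rs = length (concat (map fst rs))"
    "run_valleys rs \<subseteq> {..<length (run_path rs)}" "card (run_valleys rs) = length (filter snd rs)"
    by auto
qed

lemma contractible_valleys_run_path:
  assumes "run b" "linked P rs"
  shows "contractible_valleys (run_path ((b, f) # rs)) = contractible_valleys (run_path rs) \<union>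
    (if rs \<noteq> [] \<and> valley_link b (fst (hd rs)) then {length (run_path rs)} else {})"
proof (cases rs)
  case Nil
  then show ?thesis using assms contractible_valleys_append[of "[]" b] by (simp add: run_def)
next
  case (Cons r' rs')
  obtain c g where r': "r' = (c, g)" by fastforce
  have ne: "b \<noteq> []" "c \<noteq> []" using assms Cons r' by (auto simp: run_def)
  \<comment> \<open>From the append lemma only this is used: no other position is new. The next fact
    decides about this one.\<close>
  have "contractible_valleys (run_path rs @ block b) =
      contractible_valleys (run_path rs) \<union> (contractible_valleys (run_path rs @ block b) \<inter> {length (run_path rs)})"
    using contractible_valleys_append[OF run_path(2)[OF assms(2)] ne(1)] by auto
  moreover have "length (run_path rs) \<in> contractible_valleys (run_path rs @ block b) \<longleftrightarrow> valley_link b c"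
    using contractible_valleys_block[OF ne, of "run_path rs'"] Cons r' by simp
  ultimately show ?thesis using Cons r' by auto
qed

lemma run_valleys_contractible:
  "linked valley_link rs \<Longrightarrow> run_valleys rs \<subseteq> contractible_valleys (run_path rs)"
proof (induction rs)
  case (Cons r rs)
  obtain b f where r: "r = (b, f)" by fastforce
  have "run b" "linked valley_link rs" "f \<Longrightarrow> rs \<noteq> [] \<and> valley_link b (fst (hd rs))"
    using Cons r by auto
  then show ?case using Cons.IH contractible_valleys_run_path[of b valley_link rs f] r by auto
qed simp

text \<open>The topmost block is split off, and its flag records whether its first step is
  decorated.\<close>

lemma surj_run_path:
  "zero_area_path p \<Longrightarrow> V \<subseteq> contractible_valleys p \<Longrightarrow>
    \<exists>rs. linked valley_link rs \<and> run_path rs = p \<and> run_valleys rs = V"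
proof (induction p arbitrary: V rule: length_induct)
  case (1 p)
  show ?case
  proof (cases "p = []")
    case True
    then have "V = {}" using 1 by (simp add: contractible_valleys_def valleys_def verticals_def)
    then show ?thesis using True by (intro exI[of _ "[]"]) simp
  next
    case False
    obtain q b where q: "p = q @ block b" "run b" "q = [] \<or> last q = East" "zero_area_path q"
      using zero_area_path_split[OF 1(2) False] by metis
    let ?V = "V \<inter> contractible_valleys q"
    have "length q < length p" using q by (simp add: run_def)
    then obtain rs where rs: "linked valley_link rs" "run_path rs = q" "run_valleys rs = ?V"
      using 1(1) q(4) by (metis inf_le2)
    let ?rs = "(b, length q \<in> V) # rs"
    have cv: "contractible_valleys p = contractible_valleys q \<union>
        (if rs \<noteq> [] \<and> valley_link b (fst (hd rs)) then {length q} else {})"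
      using contractible_valleys_run_path[OF q(2) rs(1)] rs(2) q(1) by simp
    \<comment> \<open>Hence a decoration at \<open>length q\<close> can only come from the new
      block, which must then be a valley link.\<close>
    have "length q \<notin> contractible_valleys q"
      by (simp add: contractible_valleys_def valleys_def verticals_def)
    then have "linked valley_link ?rs" using 1(3) cv q(2) rs(1) by (auto split: if_splits)
    moreover have "run_valleys ?rs = V" using 1(3) cv rs by (auto split: if_splits)
    ultimately show ?thesis using q(1) rs(2) by (intro exI[of _ ?rs]) simp
  qed
qed

text \<open>On both sides the copies of \<open>c\<close> form the longest such suffix, whose length
  is read off from the reversed list.\<close>

lemma append_replicate_eq:
  assumes "xs @ replicate m c = ys @ replicate n c" "xs \<noteq> []" "ys \<noteq> []" "last xs \<noteq> c" "last ys \<noteq> c"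
  shows "xs = ys \<and> m = n"
proof -
  have "takeWhile (\<lambda>x. x = c) (rev (zs @ replicate k c)) = replicate k c"
    if "zs \<noteq> []" "last zs \<noteq> c" for zs k
    using that by (cases zs rule: rev_cases) (auto simp: takeWhile_append)
  then have "replicate m c = replicate n c" using assms by metis
  then have "m = n" by (metis length_replicate)
  then show ?thesis using assms by simp
qed

text \<open>The number of final East steps gives the length of the top block and thus its labels.
  Its flag is recovered because its position lies beyond all decorations of the lower path.\<close>

lemma inj_run_path:
  "linked P rs \<Longrightarrow> linked P qs \<Longrightarrow> run_path rs = run_path qs \<Longrightarrow> run_valleys rs = run_valleys qs \<Longrightarrow> rs = qs"
proof (induction rs arbitrary: qs)
  case Nil
  then show ?case using run_path(3)[of P qs] by simp
next
  case (Cons r rs)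
  obtain b f where r: "r = (b, f)" by fastforce
  obtain c g qs' where qs: "qs = (c, g) # qs'"
    using Cons.prems run_path(3)[of P "r # rs"] by (cases qs) auto
  have lk: "linked P rs" "linked P qs'" and ne: "b \<noteq> []" "c \<noteq> []"
    using Cons.prems r qs by (auto simp: run_def)
  have "(run_path rs @ map North b) @ replicate (length b) East = (run_path qs' @ map North c) @ replicate (length c) East"
    using Cons.prems(3) r qs by (simp add: block_def)
  from append_replicate_eq[OF this]
  have eq: "run_path rs @ map North b = run_path qs' @ map North c" "length b = length c"
    using ne by (simp_all add: last_map)
  then have "run_path rs = run_path qs'" "map North b = map North c" by simp_all
  moreover from this(2) have "b = c" by (rule map_injective) (simp add: inj_def)
  moreover have "length (run_path rs) \<notin> run_valleys rs" "length (run_path qs') \<notin> run_valleys qs'"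
    using run_path(7)[OF lk(1)] run_path(7)[OF lk(2)] by auto
  ultimately have "f = g" "run_valleys rs = run_valleys qs'"
    using Cons.prems(4) r qs by (auto simp: insert_ident split: if_splits)
  then show ?case using Cons.IH[OF lk] \<open>run_path rs = run_path qs'\<close> \<open>b = c\<close> r qs by simp
qed

lemma bij_betw_path_of_runs: "bij_betw path_of_runs (run_lists valley_link \<mu> k l) (LD0 \<mu> k l)"
proof -
  \<comment> \<open>The equivalence serves both inclusions: it also returns content and counts for
    the list found by \<open>surj_run_path\<close>.\<close>
  have iff: "path_of_runs rs \<in> LD0 \<mu> k l \<longleftrightarrow> rs \<in> run_lists valley_link \<mu> k l" if "linked valley_link rs" for rs
    using that run_path[OF that] run_valleys_contractible[OF that]
    by (auto simp: path_of_runs_def mem_LD0 run_lists_def)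
  have "inj_on path_of_runs (run_lists valley_link \<mu> k l)"
    using inj_run_path by (fastforce simp: inj_on_def run_lists_def path_of_runs_def)
  moreover have "d \<in> path_of_runs ` run_lists valley_link \<mu> k l" if d: "d \<in> LD0 \<mu> k l" for d
  proof -
    obtain p R V where pRV: "d = (p, R, V)" by (cases d) auto
    then have "zero_area_path p" "V \<subseteq> contractible_valleys p" "R = rises p" using d mem_LD0 by auto
    then obtain rs where "linked valley_link rs" "path_of_runs rs = d"
      using surj_run_path[of p V] pRV by (auto simp: path_of_runs_def)
    then show ?thesis using iff d by blast
  qed
  ultimately show ?thesis using iff unfolding bij_betw_def by (auto simp: run_lists_def)
qed


section \<open>The two special cases\<close>

lemma size_has_content:
  assumes "weak_composition n \<mu>" "has_content M \<mu>"
  shows "size M = n"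
proof -
  have "set_mset M = {i. i > 0 \<and> \<mu> i \<noteq> 0}"
  proof (rule set_eqI)
    fix i
    show "i \<in> set_mset M \<longleftrightarrow> i \<in> {i. i > 0 \<and> \<mu> i \<noteq> 0}"
      using assms(2) count_greater_zero_iff[of M i] by (auto simp: has_content_def split: if_splits)
  qed
  moreover have "count M i = \<mu> i" if "i > 0" for i using assms(2) that by (simp add: has_content_def)
  ultimately have "size M = (\<Sum>i | i > 0 \<and> \<mu> i \<noteq> 0. \<mu> i)"
    by (simp add: size_multiset_overloaded_eq)
  then show ?thesis using assms(1) by (simp add: weak_composition_def)
qed

lemma smirnov_sorted:
  "\<forall>a \<in> set w. 0 < a \<Longrightarrow> sorted_wrt (<) w \<or> sorted_wrt (>) w \<Longrightarrow> smirnov w"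
  by (induction w rule: induct_list012) auto

lemma length_SW: "weak_composition n \<mu> \<Longrightarrow> ws \<in> SW \<mu> k l \<Longrightarrow> k + l + length ws = n"
  using length_segmented_smirnov size_has_content[of n \<mu> "mset (concat ws)"] by (auto simp: SW_def)

lemma SW_blocks:
  assumes "ws \<in> SW \<mu> k l" "w \<in> set ws"
  shows "w \<noteq> []" "\<forall>a \<in> set w. 0 < a" "l = 0 \<Longrightarrow> sorted_wrt (<) w" "k = 0 \<Longrightarrow> sorted_wrt (>) w"
proof -
  have w: "w \<noteq> []" "smirnov w" using assms by (auto simp: SW_def segmented_smirnov_def)
  then show "w \<noteq> []" "\<forall>a \<in> set w. 0 < a" by (auto simp: smirnov_def)
  show "sorted_wrt (<) w" if "l = 0"
    using assms that adjacent_eq_0(1)[OF w(2)] by (auto simp: SW_def descents_adjacent)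
  show "sorted_wrt (>) w" if "k = 0"
    using assms that adjacent_eq_0(2)[OF w(2)] by (auto simp: SW_def ascents_adjacent)
qed

text \<open>Without descents, or without ascents, a block is its set of letters in increasing, or
  decreasing, order. Both cases share one proof.\<close>

lemma bij_betw_block_contents:
  assumes "n \<ge> 1" "weak_composition n \<mu>" "k = 0 \<or> l = 0"
  shows "bij_betw block_contents (SW \<mu> k l) (OP \<mu> (n - (k + l)))"
proof -
  \<comment> \<open>The inverse on a single part. If \<open>k\<close> and \<open>l\<close> are both
    \<open>0\<close>, the blocks are single letters and the order does not matter.\<close>
  define arrange where "arrange = (\<lambda>p :: nat multiset.
    (if l = 0 then sorted_list_of_multiset p else rev (sorted_list_of_multiset p)))"
  have mset_arrange: "mset (arrange p) = p" for p by (simp add: arrange_def)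
  have arrange_mset: "arrange (mset w) = w" "distinct w" if "ws \<in> SW \<mu> k l" "w \<in> set ws" for w ws
  proof -
    have "sorted_wrt (<) w \<and> l = 0 \<or> sorted_wrt (<) (rev w) \<and> l \<noteq> 0"
      using SW_blocks(3,4)[OF that] assms(3) by (auto simp: sorted_wrt_rev)
    moreover have "sorted_list_of_multiset (mset v) = v \<and> distinct v" if "sorted_wrt (<) v" for v :: "nat list"
      using that by (simp add: strict_sorted_iff sorted_sort_id)
    ultimately have "arrange (mset w) = w \<and> distinct w"
      unfolding arrange_def by (metis mset_rev rev_rev_ident distinct_rev)
    then show "arrange (mset w) = w" "distinct w" by auto
  qed
  have "block_contents ws \<in> OP \<mu> (n - (k + l))" if ws: "ws \<in> SW \<mu> k l" for ws
  proof -
    have "count (mset w) a \<le> 1" if "w \<in> set ws" for w a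
      using arrange_mset(2)[OF ws that] by (simp add: distinct_count_atmost_1)
    then show ?thesis
      using length_SW[OF assms(2) ws] SW_blocks(1)[OF ws] ws
      by (auto simp: OP_def block_contents_def SW_def mset_concat)
  qed
  moreover have "map arrange ps \<in> SW \<mu> k l" if ps: "ps \<in> OP \<mu> (n - (k + l))" for ps
  proof -
    have content: "has_content (sum_list ps) \<mu>" using ps by (simp add: OP_def)
    have p: "arrange p \<noteq> []" "\<forall>a \<in> set (arrange p). 0 < a"
      "if l = 0 then sorted_wrt (<) (arrange p) else sorted_wrt (>) (arrange p)" if "p \<in> set ps" for p
    proof -
      have "p \<noteq> {#}" "\<forall>a. count p a \<le> 1" using ps that by (auto simp: OP_def)
      then show "arrange p \<noteq> []" using mset_arrange[of p] by auto
      have "sorted_wrt (<) (sorted_list_of_multiset p)"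
      proof -
        have "count p a = (if a \<in># p then 1 else 0)" for a
        proof (cases "count p a")
          case (Suc c)
          then have "a \<in># p" by (metis count_inI nat.simps(3))
          then show ?thesis using Suc spec[OF \<open>\<forall>a. count p a \<le> 1\<close>, of a] by simp
        qed (simp add: not_in_iff)
        then show ?thesis by (simp add: strict_sorted_iff distinct_count_atmost_1)
      qed
      then show "if l = 0 then sorted_wrt (<) (arrange p) else sorted_wrt (>) (arrange p)"
        by (simp add: arrange_def sorted_wrt_rev)
      show "\<forall>a \<in> set (arrange p). 0 < a"
      proof
        fix a assume "a \<in> set (arrange p)"
        then have "a \<in># sum_list ps" using mset_arrange[of p] that
          by (metis set_mset_mset in_Union_mset_iff sum_mset_sum_list)
        then have "count (sum_list ps) a \<noteq> 0" by simp
        then show "0 < a" using content by (metis has_content_def)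
      qed
    qed
    let ?ws = "map arrange ps"
    have seg: "segmented_smirnov ?ws"
      unfolding segmented_smirnov_def using p smirnov_sorted by (smt (verit) imageE list.set_map)
    have con: "mset (concat ?ws) = sum_list ps"
      by (simp add: mset_concat comp_def mset_arrange)
    have "if l = 0 then descents ?ws = 0 else ascents ?ws = 0"
      using p(3) sorted_wrt_adjacent[of "(<)" "(>)"] sorted_wrt_adjacent[of "(>)" "(<)"]
      by (auto simp: descents_adjacent ascents_adjacent split: if_splits)
    moreover have "ascents ?ws + descents ?ws + length ps = n"
      using length_segmented_smirnov[OF seg] con size_has_content[OF assms(2) content]
      by (metis length_map size_mset)
    moreover have "length ps = n - (k + l)" using ps by (simp add: OP_def)
    \<comment> \<open>This excludes truncation in \<open>n - (k + l)\<close>: otherwise there would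
      be no parts, against \<open>n \<ge> 1\<close>.\<close>
    moreover have "k + l \<le> n"
    proof (rule ccontr)
      assume "\<not> k + l \<le> n"
      then have "ps = []" using \<open>length ps = n - (k + l)\<close> by simp
      then show False using size_has_content[OF assms(2) content] assms(1) by simp
    qed
    ultimately show ?thesis using seg con content assms(3) by (auto simp: SW_def split: if_splits)
  qed
  ultimately show ?thesis
    using arrange_mset(1) mset_arrange
    by (intro bij_betw_byWitness[where f' = "map arrange"])
      (auto simp: block_contents_def map_idI)
qed

text \<open>\<open>to_valley\<close> fixes valley links. In both special cases the cut word consists
  of such links already, which is why \<phi> extends the two given bijections.\<close>

lemma relink_id: "linked valley_link rs \<Longrightarrow> relink rs = rs"
proof (induction rs)
  case (Cons r rs)
  then show ?case by (cases r; cases rs) (auto simp: to_valley_def)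
qed simp

text \<open>Without descents every block is a single unflagged run, so there is no link to check and
  no decorated valley.\<close>

lemma path_of_runs_beta_star:
  assumes "ws \<in> SW \<mu> k 0"
  shows "path_of_runs (relink (runs_of_words ws)) = beta_star (block_contents ws)"
proof -
  let ?rs = "map (\<lambda>b. (b, False)) ws"
  have run: "\<forall>w \<in> set ws. run w" using SW_blocks[OF assms] by (simp add: run_def)
  have "runs_of_words ws = ?rs \<and> linked valley_link ?rs \<and> run_valleys ?rs = {} \<and>
      run_path ?rs = beta_star_path (map mset ws)"
    using run
  proof (induction ws)
    case (Cons w ws)
    have "sort w = w" using Cons.prems by (simp add: run_def sorted_sort_id strict_sorted_iff)
    then show ?case using Cons by (simp add: runs_of_words_run(1) beta_star_path_def block_def)
  qed (simp add: beta_star_path_def)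
  then show ?thesis by (simp add: relink_id path_of_runs_def beta_star_def block_contents_def)
qed

text \<open>In a decreasing block every letter is a run of its own, flagged unless it comes last,
  that is, unless it is the minimum. This is the flag of \<open>beta_bullet_labels\<close>.\<close>

lemma runs_of_words_decreasing:
  assumes "\<forall>w \<in> set ws. w \<noteq> [] \<and> sorted_wrt (>) w"
  shows "runs_of_words ws = concat (map (\<lambda>w. map (\<lambda>a. ([a], a \<noteq> Min (set w))) w) ws)"
  using assms
proof (induction ws rule: runs_of_words.induct)
  case (4 a b w ws)
  have ab: "b < a" using 4 by auto
  have "Min (set (b # w)) \<le> b" by simp
  then have lt: "Min (set (b # w)) < a" using ab by (rule le_less_trans)
  \<comment> \<open>The minimum of the block lies in its tail, so the flags of the tail stay as they
    are and \<open>a\<close> is flagged.\<close>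
  have "Min (set (a # b # w)) = min a (Min (set (b # w)))" by (subst list.set(2), subst Min_insert) auto
  then have "Min (set (a # b # w)) = Min (set (b # w))" "a \<noteq> Min (set (b # w))"
    using lt by auto
  then show ?case using 4 ab by simp
qed auto

text \<open>A flag sits on a singleton \<open>[a]\<close> followed by a run with a smaller first
  letter, which is the second alternative of \<open>valley_link\<close>.\<close>

lemma linked_decreasing:
  assumes "\<forall>w \<in> set ws. w \<noteq> [] \<and> sorted_wrt (>) w \<and> (\<forall>a \<in> set w. 0 < a)"
  shows "linked valley_link (runs_of_words ws)"
  using assms
proof (induction ws rule: runs_of_words.induct)
  case (4 a b w ws)
  have seg: "segmented_smirnov ((b # w) # ws)"
    using 4(5) smirnov_sorted by (auto simp: segmented_smirnov_def)
  obtain c f rs where "runs_of_words ((b # w) # ws) = (b # c, f) # rs"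
    using hd_runs_of_words[OF seg] by blast
  moreover have "linked valley_link (runs_of_words ((b # w) # ws))" using 4 by auto
  moreover have "valley_link [a] (b # c)" "run [a]" using 4(5) by (auto simp: valley_link_def run_def)
  ultimately show ?case using 4(5) by simp
qed (auto simp: run_def)

lemma length_run_path_singletons:
  "length (run_path (map (\<lambda>(a, f). ([a], f)) xs)) = 2 * length xs"
  by (induction xs) auto

text \<open>A singleton block has two steps, whence the positions \<open>2 * i\<close>. The path
  begins with the last run, whence the reversal.\<close>

lemma run_path_singletons:
  "run_path (map (\<lambda>(a, f). ([a], f)) xs) = concat (map (\<lambda>(a, d). [North a, East]) (rev xs)) \<and>
   run_valleys (map (\<lambda>(a, f). ([a], f)) xs) = {2 * i | i. i < length (rev xs) \<and> snd (rev xs ! i)}"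
proof (induction xs)
  case (Cons x xs)
  \<comment> \<open>In the reversed list the new run comes last, at index
    \<open>length xs\<close>.\<close>
  have *: "i < length (rev (x # xs)) \<and> snd (rev (x # xs) ! i) \<longleftrightarrow>
      i < length (rev xs) \<and> snd (rev xs ! i) \<or> i = length xs \<and> snd x" for i
    by (cases "i < length xs"; cases "i = length xs") (simp_all add: nth_append)
  have "{2 * i | i. i < length (rev (x # xs)) \<and> snd (rev (x # xs) ! i)} =
      {2 * i | i. i < length (rev xs) \<and> snd (rev xs ! i)} \<union> (if snd x then {2 * length xs} else {})"
    unfolding * by auto
  then show ?case using Cons length_run_path_singletons[of xs] by (cases x) (simp add: block_def Un_commute)
qed simp

lemma path_of_runs_beta_bullet:
  assumes "ws \<in> SW \<mu> 0 l"
  shows "path_of_runs (relink (runs_of_words ws)) = beta_bullet (block_contents ws)"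
proof -
  have ws: "\<forall>w \<in> set ws. w \<noteq> [] \<and> sorted_wrt (>) w \<and> (\<forall>a \<in> set w. 0 < a)"
    using SW_blocks[OF assms] by simp
  define xs where "xs = concat (map (\<lambda>w. map (\<lambda>a. (a, a \<noteq> Min (set w))) w) ws)"
  have rs: "runs_of_words ws = map (\<lambda>(a, f). ([a], f)) xs" "linked valley_link (runs_of_words ws)"
    using runs_of_words_decreasing[of ws] linked_decreasing[OF ws] ws
    by (simp_all add: xs_def map_concat comp_def)
  have "sort w = rev w" if "w \<in> set ws" for w
  proof -
    have "sorted_wrt (<) (rev w)" using ws that by (simp add: sorted_wrt_rev)
    then show ?thesis by (metis mset_rev sorted_list_of_multiset_mset sorted_sort_id strict_sorted_iff)
  qed
  then have labels: "beta_bullet_labels (block_contents ws) = rev xs"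
    by (auto simp: beta_bullet_labels_def block_contents_def xs_def rev_concat rev_map comp_def
        intro!: arg_cong[where f = concat])
  \<comment> \<open>\<open>beta_bullet\<close> decorates no rises. There are as many runs as
    letters, so the count in \<open>run_path\<close> leaves no rise.\<close>
  have "rises (run_path (runs_of_words ws)) = {}"
  proof -
    have "concat (map fst (map (\<lambda>(a, f). ([a], f)) xs)) = map fst xs"
      by (induction xs) auto
    then have "card (rises (run_path (runs_of_words ws))) = 0"
      using run_path(6)[OF rs(2)] rs(1) by simp
    moreover have "finite (rises (run_path (runs_of_words ws)))" by (simp add: rises_def verticals_def)
    ultimately show ?thesis by simp
  qed
  then show ?thesis
    using run_path_singletons[of xs] rs labels
    by (simp add: relink_id path_of_runs_def beta_bullet_def Let_def)
qed

theorem theorem4p8: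
  fixes n k l :: nat and \<mu> :: "nat \<Rightarrow> nat"
  assumes "n \<ge> 1" and "weak_composition n \<mu>"
  shows "\<exists>\<phi>. bij_betw \<phi> (SW \<mu> k l) (LD0 \<mu> k l) \<and>
    (l = 0 \<longrightarrow>
       bij_betw block_contents (SW \<mu> k 0) (OP \<mu> (n - k)) \<and>
       bij_betw beta_star (OP \<mu> (n - k)) (LD0 \<mu> k 0) \<and>
       (\<forall>w \<in> SW \<mu> k 0. \<phi> w = beta_star (block_contents w))) \<and>
    (k = 0 \<longrightarrow>
       bij_betw block_contents (SW \<mu> 0 l) (OP \<mu> (n - l)) \<and>
       bij_betw beta_bullet (OP \<mu> (n - l)) (LD0 \<mu> 0 l) \<and>
       (\<forall>w \<in> SW \<mu> 0 l. \<phi> w = beta_bullet (block_contents w)))"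
proof -
  define \<phi> where "\<phi> = path_of_runs \<circ> (relink \<circ> runs_of_words)"
  \<comment> \<open>The same \<phi> works for all \<open>k\<close> and \<open>l\<close>, so this can
    be instantiated at \<open>(k, 0)\<close> and \<open>(0, l)\<close>.\<close>
  have bij: "bij_betw \<phi> (SW \<mu> k l) (LD0 \<mu> k l)" for k l
    unfolding \<phi>_def
    using bij_betw_trans[OF bij_betw_trans[OF bij_betw_runs_of_words bij_betw_relink] bij_betw_path_of_runs] .
  \<comment> \<open>Bijectivity of \<open>beta_star\<close> and \<open>beta_bullet\<close> is not
    shown directly: each is the right factor of \<phi> after the bijection
    \<open>block_contents\<close>.\<close>
  have right: "bij_betw g B C"
    if "bij_betw f A B" "bij_betw \<phi> A C" "\<forall>w \<in> A. \<phi> w = g (f w)" for f g A B C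
    using that by (metis (no_types, lifting) bij_betw_comp_iff bij_betw_cong comp_apply)
  have star: "\<forall>w \<in> SW \<mu> k 0. \<phi> w = beta_star (block_contents w)"
    using path_of_runs_beta_star by (simp add: \<phi>_def)
  have bullet: "\<forall>w \<in> SW \<mu> 0 l. \<phi> w = beta_bullet (block_contents w)"
    using path_of_runs_beta_bullet by (simp add: \<phi>_def)
  have bcs: "bij_betw block_contents (SW \<mu> k 0) (OP \<mu> (n - k))"
    "bij_betw block_contents (SW \<mu> 0 l) (OP \<mu> (n - l))"
    using bij_betw_block_contents[OF assms, of k 0] bij_betw_block_contents[OF assms, of 0 l] by simp_all
  show ?thesis
    using bij bcs star bullet right[OF bcs(1) bij star] right[OF bcs(2) bij bullet] by blast
qed

end
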